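(* Let $X$ be a nonempty set, let $d\in\mathbb{N}$, and let $\mathbf{K}:X\times X\to\mathbb{R}^{d\times d}$ be an admissible multi-task kernel. Assume that all the minimal norm interpolation problems and all the regularization network problems on $\mathcal{B}_{\mathbf{K}}$ described in the context have minimizers in $\mathcal{B}_{\mathbf{K}}$. Then $\mathcal{B}_{\mathbf{K}}$ satisfies the linear representer theorem for regularization network if and only if for all $m\in\mathbb{N}$ and all pairwise distinct points $\mathbf{x}=\{x_j:j\in\mathbb{N}_m\}\subseteq X$, $$\sup_{t\in X}\|\mathbf{K}[\mathbf{x}]^{-1}\mathbf{K}_{\mathbf{x}}(t)\|_1\le1.$$
   Context: $\mathbb{N}=\{1,2,\dots\}$, $\mathbb{N}_m=\{1,\dots,m\}$, $\mathbb{R}_+=[0,\infty)$. For a vector, $\|\cdot\|_p$ is the $\ell^p$ norm; for a matrix, $\|\cdot\|_p$ is the $\ell^p$-induced operator norm. For a nonempty set $\Omega$, $\ell^1_d(\Omega)=\{\boldsymbol{c}=(\boldsymbol{c}_t\in\mathbb{R}^d:t\in\Omega): \|\boldsymbol{c}\|_{\ell^1_d(\Omega)}=\sum_{t\in\Omega}\|\boldsymbol{c}_t\|_1<\infty\}$, and $\mathrm{supp}\,\boldsymbol{c}=\{t:\boldsymbol{c}_t\ne0\}$. For points $\mathbf{x}=\{x_1,\dots,x_m\}$, $\mathbf{K}[\mathbf{x}]\in\mathbb{R}^{md\times md}$ is the block matrix whose $(j,k)$ block is $\mathbf{K}(x_k,x_j)$, and for $t\in X$, $\mathbf{K}_{\mathbf{x}}(t)=(\mathbf{K}(t,x_j):j\in\mathbb{N}_m)^\top\in\mathbb{R}^{md\times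 d}$ is the block column whose $j$-th block is $\mathbf{K}(t,x_j)$. Admissible multi-task kernel: a function $\mathbf{K}:X\times X\to\mathbb{R}^{d\times d}$ with $\mathbf{K}(x,x')^\top=\mathbf{K}(x,x')$ for all $x,x'\in X$ such that (A1) $\mathbf{K}[\mathbf{x}]$ is non-singular for all finite sets $\mathbf{x}$ of pairwise distinct points of $X$; (A2) there is $\kappa>0$ with $\|\mathbf{K}(x,x')\|_1\le\kappa$ for all $x,x'\in X$; (A3) for all pairwise distinct $x_j\in X$, $j\in\mathbb{N}$, and $(\boldsymbol{c}_j)_{j\in\mathbb{N}}\in\ell^1_d(\mathbb{N})$, if $\sum_{j\in\mathbb{N}}\mathbf{K}(x_j,x)\boldsymbol{c}_j=0$ for all $x\in X$, then $\boldsymbol{c}_j=0$ for all $j$. The space $\mathcal{B}_{\mathbf{K}}=\{\sum_{x\in\mathrm{supp}\,\boldsymbol{c}}\mathbf{K}(x,\cdot)\boldsymbol{c}_x:\boldsymbol{c}\in\ell^1_d(X)\}$ carries the norm $\|\sum_{x\in\mathrm{supp}\,\boldsymbol{c}}\mathbf{K}(x,\cdot)\boldsymbol{c}_x\|_{\mathcal{B}_{\mathbf{K}}}=\|\boldsymbol{c}\|_{\ell^1_d(X)}$. For sampling data $\{(x_j,\boldsymbol{y}_j):j\in\mathbb{N}_m\}\subseteq X\times\mathbb{R}^d$ with $x_j$ pairwise distinct, write $\mathbf{x}=\{x_j\}$, $\boldsymbol{y}=(\boldsymbol{y}_1,\dots,\boldsymbol{y}_m)\in\mathbb{R}^{md}$,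 $f(\mathbf{x})=(f(x_1),\dots,f(x_m))\in\mathbb{R}^{md}$, $\mathcal{I}_{\mathbf{x}}(\boldsymbol{y})=\{f\in\mathcal{B}_{\mathbf{K}}:f(\mathbf{x})=\boldsymbol{y}\}$, $\mathcal{S}^{\mathbf{x}}=\{\sum_{j=1}^m\mathbf{K}(x_j,\cdot)\boldsymbol{c}_j:\boldsymbol{c}_j\in\mathbb{R}^d\}$. Minimal norm interpolation problem: $\min_{f\in\mathcal{I}_{\mathbf{x}}(\boldsymbol{y})}\|f\|_{\mathcal{B}_{\mathbf{K}}}$. Regularization network problem: $\min_{f\in\mathcal{B}_{\mathbf{K}}}L(f(\mathbf{x}),\boldsymbol{y})+\lambda\phi(\|f\|_{\mathcal{B}_{\mathbf{K}}})$, where $\lambda>0$, $L:\mathbb{R}^{md}\times\mathbb{R}^{md}\to\mathbb{R}_+$ is continuous with $L(\boldsymbol{t},\boldsymbol{t})=0$ for all $\boldsymbol{t}\in\mathbb{R}^{md}$, and $\phi:\mathbb{R}_+\to\mathbb{R}_+$ is continuous, non-decreasing, with $\lim_{t\to+\infty}\phi(t)=+\infty$. $\mathcal{B}_{\mathbf{K}}$ satisfies the linear representer theorem for regularization network if for every $m\in\mathbb{N}$, all such sampling data, all such $L$ and $\phi$, and every $\lambda>0$, this problem has a minimizer in $\mathcal{S}^{\mathbf{x}}$. *)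

theory Defs
  imports "HOL-Analysis.Analysis"
begin

text \<open>
  The input set \<open>X\<close> is a carrier set, and functions from \<open>X\<close> to \<open>\<real>\<^sup>d\<close> are extensional functions
  \<open>'x \<Rightarrow> real ^ 'd\<close> (constantly \<^term>\<open>undefined\<close> off \<open>X\<close>), so that HOL equality is equality on \<open>X\<close>;
  \<open>d = CARD('d)\<close>.  Since the number \<open>m\<close> of points is quantified inside the statements,
  \<open>\<real>\<^sup>m\<^sup>d\<close> is the set of extensional functions from \<open>{1..m}\<close> to \<open>real ^ 'd\<close>, and matrices with \<open>m\<close> rows
  of blocks are functions on block indices, of which only the values on \<open>{1..m}\<close> matter.
\<close>

definition l1_norm :: "real ^ 'd \<Rightarrow> real" where
  "l1_norm v = (\<Sum>i\<in>UNIV. \<bar>v $ i\<bar>)"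

definition l1_opnorm :: "real ^ 'd ^ 'd \<Rightarrow> real" where
  "l1_opnorm A = (SUP u\<in>{u. l1_norm u = 1}. l1_norm (A *v u))"

definition supp_on :: "'t set \<Rightarrow> ('t \<Rightarrow> real ^ 'd) \<Rightarrow> 't set" where
  "supp_on \<Omega> c = {t \<in> \<Omega>. c t \<noteq> 0}"

text \<open>Families indexed by \<open>\<Omega>\<close> are total functions whose values off \<open>\<Omega>\<close> are irrelevant.\<close>

definition ell1 :: "'t set \<Rightarrow> ('t \<Rightarrow> real ^ 'd) set" where
  "ell1 \<Omega> = {c. (\<lambda>t. l1_norm (c t)) summable_on \<Omega>}"

definition ell1_norm :: "'t set \<Rightarrow> ('t \<Rightarrow> real ^ 'd) \<Rightarrow> real" where
  "ell1_norm \<Omega> c = (\<Sum>\<^sub>\<infinity>t\<in>\<Omega>. l1_norm (c t))"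

subsection \<open>Block matrices\<close>

text \<open>An \<open>md \<times> md\<close> matrix is given by its \<open>d \<times> d\<close> blocks \<open>A j k\<close>, an \<open>md \<times> d\<close> matrix by its
  blocks \<open>M j\<close>, for \<open>j, k \<in> {1..m}\<close>.\<close>

type_synonym 'd blocks = "nat \<Rightarrow> nat \<Rightarrow> real ^ 'd ^ 'd"
type_synonym 'd block_col = "nat \<Rightarrow> real ^ 'd ^ 'd"

definition block_mult :: "nat \<Rightarrow> 'd blocks \<Rightarrow> 'd blocks \<Rightarrow> 'd::finite blocks" where
  "block_mult m A B = (\<lambda>j k. \<Sum>l=1..m. A j l ** B l k)"

definition block_mult_col :: "nat \<Rightarrow> 'd blocks \<Rightarrow> 'd block_col \<Rightarrow> 'd::finite block_col" where
  "block_mult_col m A M = (\<lambda>j. \<Sum>l=1..m. A j l ** M l)"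

definition is_block_id :: "nat \<Rightarrow> 'd::finite blocks \<Rightarrow> bool" where
  "is_block_id m A \<longleftrightarrow> (\<forall>j\<in>{1..m}. \<forall>k\<in>{1..m}. A j k = (if j = k then mat 1 else 0))"

definition is_block_inverse :: "nat \<Rightarrow> 'd::finite blocks \<Rightarrow> 'd blocks \<Rightarrow> bool" where
  "is_block_inverse m A B \<longleftrightarrow> is_block_id m (block_mult m A B) \<and> is_block_id m (block_mult m B A)"

definition block_nonsingular :: "nat \<Rightarrow> 'd::finite blocks \<Rightarrow> bool" where
  "block_nonsingular m A \<longleftrightarrow> (\<exists>B. is_block_inverse m A B)"

definition block_inv :: "nat \<Rightarrow> 'd::finite blocks \<Rightarrow> 'd blocks" where
  "block_inv m A = (SOME B. is_block_inverse m A B)"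

definition block_col_opnorm :: "nat \<Rightarrow> 'd::finite block_col \<Rightarrow> real" where
  "block_col_opnorm m M = (SUP u\<in>{u. l1_norm u = 1}. \<Sum>j=1..m. l1_norm (M j *v u))"

subsection \<open>Admissible multi-task kernels\<close>

definition distinct_points :: "'x set \<Rightarrow> nat \<Rightarrow> (nat \<Rightarrow> 'x) \<Rightarrow> bool" where
  "distinct_points X m x \<longleftrightarrow> x ` {1..m} \<subseteq> X \<and> inj_on x {1..m}"

text \<open>Mind the order of the arguments: block \<open>(j, k)\<close> is \<open>K (x k) (x j)\<close>.\<close>

definition kernel_matrix :: "('x \<Rightarrow> 'x \<Rightarrow> real ^ 'd ^ 'd) \<Rightarrow> (nat \<Rightarrow> 'x) \<Rightarrow> 'd::finite blocks" where
  "kernel_matrix K x = (\<lambda>j k. K (x k) (x j))"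

text \<open>By the boundedness condition on admissible kernels, real suprema over \<open>t \<in> X\<close> of norms of matrix
  multiples of the following block column are taken over bounded sets.\<close>

definition kernel_col ::
    "('x \<Rightarrow> 'x \<Rightarrow> real ^ 'd ^ 'd) \<Rightarrow> (nat \<Rightarrow> 'x) \<Rightarrow> 'x \<Rightarrow> 'd::finite block_col" where
  "kernel_col K x t = (\<lambda>j. K t (x j))"

definition admissible_kernel :: "'x set \<Rightarrow> ('x \<Rightarrow> 'x \<Rightarrow> real ^ 'd ^ 'd::finite) \<Rightarrow> bool" where
  "admissible_kernel X K \<longleftrightarrow>
     (\<forall>x\<in>X. \<forall>x'\<in>X. transpose (K x x') = K x x') \<and>
     (\<forall>m\<ge>1. \<forall>x. distinct_points X m x \<longrightarrow> block_nonsingular m (kernel_matrix K x)) \<and>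
     (\<exists>\<kappa>>0. \<forall>x\<in>X. \<forall>x'\<in>X. l1_opnorm (K x x') \<le> \<kappa>) \<and>
     (\<forall>x c. x ` {1..} \<subseteq> X \<and> inj_on x {1::nat..} \<and> c \<in> ell1 {1..} \<and>
        (\<forall>t\<in>X. (\<Sum>\<^sub>\<infinity>j\<in>{1..}. K (x j) t *v c j) = 0)
        \<longrightarrow> (\<forall>j\<in>{1..}. c j = 0))"

subsection \<open>The space \<open>B\<^sub>K\<close>\<close>

definition kernel_series ::
    "'x set \<Rightarrow> ('x \<Rightarrow> 'x \<Rightarrow> real ^ 'd ^ 'd) \<Rightarrow> ('x \<Rightarrow> real ^ 'd) \<Rightarrow> ('x \<Rightarrow> real ^ 'd::finite)" where
  "kernel_series X K c = (\<lambda>t\<in>X. \<Sum>\<^sub>\<infinity>x\<in>supp_on X c. K x t *v c x)"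

definition BK :: "'x set \<Rightarrow> ('x \<Rightarrow> 'x \<Rightarrow> real ^ 'd ^ 'd) \<Rightarrow> ('x \<Rightarrow> real ^ 'd::finite) set" where
  "BK X K = kernel_series X K ` ell1 X"

text \<open>For an admissible kernel the coefficient family of an element of \<open>B\<^sub>K\<close> is unique on \<open>X\<close>.\<close>

definition BK_norm ::
    "'x set \<Rightarrow> ('x \<Rightarrow> 'x \<Rightarrow> real ^ 'd ^ 'd) \<Rightarrow> ('x \<Rightarrow> real ^ 'd::finite) \<Rightarrow> real" where
  "BK_norm X K f = (THE r. \<exists>c\<in>ell1 X. f = kernel_series X K c \<and> r = ell1_norm X c)"

definition kernel_span ::
    "'x set \<Rightarrow> ('x \<Rightarrow> 'x \<Rightarrow> real ^ 'd ^ 'd) \<Rightarrow> nat \<Rightarrow> (nat \<Rightarrow> 'x) \<Rightarrow> ('x \<Rightarrow> real ^ 'd::finite) set" where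
  "kernel_span X K m x = {f. \<exists>c. f = (\<lambda>t\<in>X. \<Sum>j=1..m. K (x j) t *v c j)}"

subsection \<open>Learning problems\<close>

definition Rmd :: "nat \<Rightarrow> (nat \<Rightarrow> real ^ 'd) set" where
  "Rmd m = {1..m} \<rightarrow>\<^sub>E UNIV"

definition sample :: "nat \<Rightarrow> (nat \<Rightarrow> 'x) \<Rightarrow> ('x \<Rightarrow> real ^ 'd) \<Rightarrow> (nat \<Rightarrow> real ^ 'd)" where
  "sample m x f = (\<lambda>j\<in>{1..m}. f (x j))"

definition sampling_data :: "'x set \<Rightarrow> nat \<Rightarrow> (nat \<Rightarrow> 'x) \<Rightarrow> (nat \<Rightarrow> real ^ 'd) \<Rightarrow> bool" where
  "sampling_data X m x y \<longleftrightarrow> m \<ge> 1 \<and> distinct_points X m x \<and> y \<in> Rmd m"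

definition interpolants ::
    "'x set \<Rightarrow> ('x \<Rightarrow> 'x \<Rightarrow> real ^ 'd ^ 'd) \<Rightarrow> nat \<Rightarrow> (nat \<Rightarrow> 'x) \<Rightarrow> (nat \<Rightarrow> real ^ 'd) \<Rightarrow>
     ('x \<Rightarrow> real ^ 'd::finite) set" where
  "interpolants X K m x y = {f \<in> BK X K. sample m x f = y}"

definition min_norm_interpolant ::
    "'x set \<Rightarrow> ('x \<Rightarrow> 'x \<Rightarrow> real ^ 'd ^ 'd) \<Rightarrow> nat \<Rightarrow> (nat \<Rightarrow> 'x) \<Rightarrow> (nat \<Rightarrow> real ^ 'd) \<Rightarrow>
     ('x \<Rightarrow> real ^ 'd::finite) \<Rightarrow> bool" where
  "min_norm_interpolant X K m x y f \<longleftrightarrow>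
     is_arg_min (BK_norm X K) (\<lambda>g. g \<in> interpolants X K m x y) f"

text \<open>Continuity refers to the product topology on \<open>nat \<Rightarrow> real ^ 'd\<close>, which induces the Euclidean
  topology on \<^term>\<open>Rmd m\<close>.\<close>

definition loss_function ::
    "nat \<Rightarrow> ((nat \<Rightarrow> real ^ 'd) \<Rightarrow> (nat \<Rightarrow> real ^ 'd) \<Rightarrow> real) \<Rightarrow> bool" where
  "loss_function m L \<longleftrightarrow>
     continuous_on (Rmd m \<times> Rmd m) (\<lambda>(s, t). L s t) \<and>
     (\<forall>s\<in>Rmd m. \<forall>t\<in>Rmd m. L s t \<ge> 0) \<and>
     (\<forall>t\<in>Rmd m. L t t = 0)"

definition regularizer :: "(real \<Rightarrow> real) \<Rightarrow> bool" where
  "regularizer \<phi> \<longleftrightarrow>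
     continuous_on {0..} \<phi> \<and> mono_on {0..} \<phi> \<and> (\<forall>t\<ge>0. \<phi> t \<ge> 0) \<and> filterlim \<phi> at_top at_top"

text \<open>The regularization parameter is written \<open>\<mu>\<close>, since \<open>\<lambda>\<close> is reserved for abstraction.\<close>

definition reg_network_minimizer ::
    "'x set \<Rightarrow> ('x \<Rightarrow> 'x \<Rightarrow> real ^ 'd ^ 'd) \<Rightarrow> nat \<Rightarrow> (nat \<Rightarrow> 'x) \<Rightarrow> (nat \<Rightarrow> real ^ 'd) \<Rightarrow>
     ((nat \<Rightarrow> real ^ 'd) \<Rightarrow> (nat \<Rightarrow> real ^ 'd) \<Rightarrow> real) \<Rightarrow> (real \<Rightarrow> real) \<Rightarrow> real \<Rightarrow>
     ('x \<Rightarrow> real ^ 'd::finite) \<Rightarrow> bool" where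
  "reg_network_minimizer X K m x y L \<phi> \<mu> f \<longleftrightarrow>
     is_arg_min (\<lambda>g. L (sample m x g) y + \<mu> * \<phi> (BK_norm X K g)) (\<lambda>g. g \<in> BK X K) f"

definition reg_network_representer :: "'x set \<Rightarrow> ('x \<Rightarrow> 'x \<Rightarrow> real ^ 'd ^ 'd::finite) \<Rightarrow> bool" where
  "reg_network_representer X K \<longleftrightarrow>
     (\<forall>m x y L \<phi> \<mu>. sampling_data X m x y \<and> loss_function m L \<and> regularizer \<phi> \<and> \<mu> > 0 \<longrightarrow>
        (\<exists>f\<in>kernel_span X K m x. reg_network_minimizer X K m x y L \<phi> \<mu> f))"

end

theory Submission
  imports Defs
begin

text \<open>
  Write \<open>B\<close> for the inverse of the kernel matrix at \<open>x\<close>.  The coefficients of the interpolant in the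
  span of the data of \<open>f = \<Sum>\<^sub>t K(t,\<cdot>) c\<^sub>t\<close> are \<open>\<Sum>\<^sub>t B K\<^sub>x(t) c\<^sub>t\<close>.  If all \<open>B K\<^sub>x(t)\<close> have norm at most 1,
  replacing a minimizer \<open>f\<close> by this interpolant keeps the loss and does not increase the norm.
  Conversely, take \<open>y = K\<^sub>x(t) u\<close>, the data of \<open>K(t,\<cdot>) u\<close>, the loss \<open>L(s, s') = \<parallel>B (s - s')\<parallel>\<^sub>1\<close>, the identity
  as regularizer and parameter 1.  A minimizer in the span with coefficients \<open>c\<close> satisfies
  \<open>\<parallel>B y\<parallel>\<^sub>1 \<le> \<parallel>c - B y\<parallel>\<^sub>1 + \<parallel>c\<parallel>\<^sub>1\<close>, and the right-hand side is its objective, which is at most the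
  objective \<open>\<parallel>u\<parallel>\<^sub>1\<close> of \<open>K(t,\<cdot>) u\<close>.
\<close>

section \<open>The norm on coefficients\<close>

lemma l1_norm_nonneg [simp]: "0 \<le> l1_norm v"
  unfolding l1_norm_def by (simp add: sum_nonneg)

lemma norm_le_l1_norm: "norm v \<le> l1_norm v"
  unfolding l1_norm_def by (rule norm_le_l1_cart)

lemma l1_norm_zero [simp]: "l1_norm 0 = 0"
  by (simp add: l1_norm_def)

lemma l1_norm_eq_0 [simp]: "l1_norm v = 0 \<longleftrightarrow> v = 0"
  using norm_le_l1_norm[of v] by auto

lemma l1_norm_triangle: "l1_norm (v + w) \<le> l1_norm v + l1_norm w"
  unfolding l1_norm_def by (simp flip: sum.distrib add: sum_mono abs_triangle_ineq)

lemma l1_norm_scaleR: "l1_norm (r *\<^sub>R v) = \<bar>r\<bar> * l1_norm v"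
  by (simp add: l1_norm_def abs_mult sum_distrib_left)

lemma l1_norm_diff_le: "l1_norm (v - w) \<le> l1_norm v + l1_norm w"
  using l1_norm_triangle[of v "- w"] by (simp add: l1_norm_def)

lemma l1_norm_sum: "l1_norm (sum f A) \<le> (\<Sum>x\<in>A. l1_norm (f x))"
proof (induction A rule: infinite_finite_induct)
  case (insert x A)
  then show ?case
    using l1_norm_triangle[of "f x" "sum f A"] by simp
qed simp_all

lemma continuous_on_l1_norm:
  "continuous_on S f \<Longrightarrow> continuous_on S (\<lambda>x. l1_norm (f x))"
  unfolding l1_norm_def by (intro continuous_intros)

section \<open>Infinite sums and the l1 norm\<close>

lemma has_sum_sum:
  fixes f :: "'i \<Rightarrow> 'a \<Rightarrow> 'b :: topological_comm_monoid_add"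
  assumes "\<And>i. i \<in> I \<Longrightarrow> (f i has_sum s i) A"
  shows "((\<lambda>t. \<Sum>i\<in>I. f i t) has_sum (\<Sum>i\<in>I. s i)) A"
  using assms
  by (induction I rule: infinite_finite_induct) (simp_all add: has_sum_0 has_sum_add)

lemma
  fixes f :: "'i \<Rightarrow> 'a \<Rightarrow> 'b :: {topological_comm_monoid_add, t2_space}"
  assumes "\<And>i. i \<in> I \<Longrightarrow> f i summable_on A"
  shows summable_on_sum: "(\<lambda>t. \<Sum>i\<in>I. f i t) summable_on A"
    and infsum_sum: "(\<Sum>\<^sub>\<infinity>t\<in>A. \<Sum>i\<in>I. f i t) = (\<Sum>i\<in>I. infsum (f i) A)"
proof -
  have "((\<lambda>t. \<Sum>i\<in>I. f i t) has_sum (\<Sum>i\<in>I. infsum (f i) A)) A"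
    using assms by (intro has_sum_sum has_sum_infsum)
  then show "(\<lambda>t. \<Sum>i\<in>I. f i t) summable_on A"
    and "(\<Sum>\<^sub>\<infinity>t\<in>A. \<Sum>i\<in>I. f i t) = (\<Sum>i\<in>I. infsum (f i) A)"
    by (auto simp: has_sum_imp_summable infsumI)
qed

lemma summable_on_if_l1_norm:
  fixes f :: "'a \<Rightarrow> real ^ 'd"
  assumes "(\<lambda>t. l1_norm (f t)) summable_on A"
  shows "f summable_on A"
  by (rule Infinite_Sum.abs_summable_summable, rule Infinite_Sum.abs_summable_on_comparison_test'[OF assms norm_le_l1_norm])

text \<open>The class norm on \<open>real ^ 'd\<close> is Euclidean, so the triangle inequality for
  infinite sums is applied to each real coordinate; the finite sum over coordinates is then
  exchanged with the infinite one.\<close>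

lemma l1_norm_infsum_le:
  fixes f :: "'a \<Rightarrow> real ^ 'd"
  assumes "(\<lambda>t. l1_norm (f t)) summable_on A"
  shows "l1_norm (infsum f A) \<le> (\<Sum>\<^sub>\<infinity>t\<in>A. l1_norm (f t))"
proof -
  have abs: "(\<lambda>t. \<bar>f t $ i\<bar>) summable_on A" for i
    using assms
  proof (rule summable_on_comparison_test)
    show "\<bar>f t $ i\<bar> \<le> l1_norm (f t)" for t
      unfolding l1_norm_def by (rule member_le_sum) auto
  qed auto
  have "\<bar>infsum f A $ i\<bar> \<le> (\<Sum>\<^sub>\<infinity>t\<in>A. \<bar>f t $ i\<bar>)" for i
  proof -
    have "infsum f A $ i = (\<Sum>\<^sub>\<infinity>t\<in>A. f t $ i)"
      using has_sum_bounded_linear[OF bounded_linear_vec_nth[of i]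
          has_sum_infsum[OF summable_on_if_l1_norm[OF assms]]]
      by (simp add: infsumI)
    then show ?thesis
      using norm_infsum_bound[of "\<lambda>t. f t $ i" A] abs by simp
  qed
  then have "l1_norm (infsum f A) \<le> (\<Sum>i\<in>UNIV. \<Sum>\<^sub>\<infinity>t\<in>A. \<bar>f t $ i\<bar>)"
    unfolding l1_norm_def by (rule sum_mono)
  also have "\<dots> = (\<Sum>\<^sub>\<infinity>t\<in>A. l1_norm (f t))"
    unfolding l1_norm_def using abs by (simp add: infsum_sum)
  finally show ?thesis .
qed

lemma ell1_diff:
  assumes "b \<in> ell1 \<Omega>" "c \<in> ell1 \<Omega>"
  shows "(\<lambda>t. b t - c t) \<in> ell1 \<Omega>"
proof -
  have "(\<lambda>t. l1_norm (b t) + l1_norm (c t)) summable_on \<Omega>"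
    using assms by (auto simp: ell1_def intro: summable_on_add)
  then show ?thesis
    unfolding ell1_def mem_Collect_eq
    by (rule summable_on_comparison_test) (auto intro: l1_norm_diff_le)
qed

section \<open>Block matrices\<close>

lemma sum_matrix_vector_mult: "(\<Sum>i\<in>I. A i) *v v = (\<Sum>i\<in>I. A i *v v)"
  for A :: "'i \<Rightarrow> real ^ 'n ^ 'm"
  by (induction I rule: infinite_finite_induct)
    (simp_all add: matrix_vector_mult_add_rdistrib)

lemma matrix_vector_mult_sum: "A *v (\<Sum>i\<in>I. v i) = (\<Sum>i\<in>I. A *v v i)"
  for A :: "real ^ 'n ^ 'm"
  by (rule linear_sum) simp

text \<open>The action of a block matrix on a stacked vector. The result is not cut off outside
  \<open>{1..m}\<close>; values there are formal, and the inverse laws concern only indices in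
  range.\<close>

definition block_apply :: "nat \<Rightarrow> 'd blocks \<Rightarrow> (nat \<Rightarrow> real ^ 'd) \<Rightarrow> nat \<Rightarrow> real ^ 'd::finite" where
  "block_apply m A v = (\<lambda>j. \<Sum>l=1..m. A j l *v v l)"

lemma block_apply_cong:
  assumes "\<And>l. l \<in> {1..m} \<Longrightarrow> v l = w l"
  shows "block_apply m A v = block_apply m A w"
  unfolding block_apply_def using assms by (intro ext sum.cong) auto

lemma block_apply_diff:
  "block_apply m A (\<lambda>l. v l - w l) j = block_apply m A v j - block_apply m A w j"
  by (simp add: block_apply_def matrix_vector_mult_diff_distrib sum_subtractf)

text \<open>Associativity of the matrix product, by exchanging two finite sums. Both orders matter
  later: kernel matrix after inverse gives interpolation, inverse after kernel matrix recovers
  coefficients.\<close>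

lemma block_apply_block_id:
  assumes "is_block_id m (block_mult m A B)" "j \<in> {1..m}"
  shows "block_apply m A (block_apply m B v) j = v j"
proof -
  have "block_apply m A (block_apply m B v) j = (\<Sum>k=1..m. block_mult m A B j k *v v k)"
    unfolding block_apply_def block_mult_def sum_matrix_vector_mult matrix_vector_mult_sum
      matrix_vector_mul_assoc
    by (rule sum.swap)
  also have "\<dots> = (\<Sum>k=1..m. if k = j then v j else 0)"
    using assms by (intro sum.cong) (auto simp: is_block_id_def)
  also have "\<dots> = v j"
    using assms(2) by simp
  finally show ?thesis .
qed

lemma block_mult_col_mult: "block_mult_col m A M j *v u = block_apply m A (\<lambda>l. M l *v u) j"
  by (simp add: block_mult_col_def block_apply_def sum_matrix_vector_mult matrix_vector_mul_assoc)

lemma is_block_inverse_block_inv: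
  "block_nonsingular m A \<Longrightarrow> is_block_inverse m A (block_inv m A)"
  unfolding block_nonsingular_def block_inv_def by (metis someI_ex)

section \<open>Operator norms as suprema over nonempty bounded sets\<close>

lemma unit_l1_nonempty: "{u :: real ^ 'd::finite. l1_norm u = 1} \<noteq> {}"
proof -
  have "l1_norm (axis undefined 1 :: real ^ 'd) = 1"
    by (simp add: l1_norm_def axis_def if_distrib cong: if_cong)
  then show ?thesis by blast
qed

text \<open>The sum of the absolute values of all entries serves as \<open>C\<close>: crude, but
  enough to show that the sets whose suprema are taken are bounded.\<close>

lemma l1_norm_mult_bounded: "\<exists>C\<ge>0. \<forall>u. l1_norm (A *v u) \<le> C * l1_norm u"
  for A :: "real ^ 'n ^ 'm"
proof (intro exI conjI allI)
  show "0 \<le> (\<Sum>i\<in>UNIV. \<Sum>k\<in>UNIV. \<bar>A $ i $ k\<bar>)"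
    by (simp add: sum_nonneg)
  show "l1_norm (A *v u) \<le> (\<Sum>i\<in>UNIV. \<Sum>k\<in>UNIV. \<bar>A $ i $ k\<bar>) * l1_norm u" for u
  proof -
    have "\<bar>(A *v u) $ i\<bar> \<le> (\<Sum>k\<in>UNIV. \<bar>A $ i $ k\<bar>) * l1_norm u" for i
    proof -
      have "\<bar>(A *v u) $ i\<bar> \<le> (\<Sum>k\<in>UNIV. \<bar>A $ i $ k\<bar> * \<bar>u $ k\<bar>)"
        unfolding matrix_vector_mult_def by (simp flip: abs_mult)
      also have "\<dots> \<le> (\<Sum>k\<in>UNIV. \<bar>A $ i $ k\<bar> * l1_norm u)"
        unfolding l1_norm_def by (intro sum_mono mult_left_mono member_le_sum) auto
      finally show ?thesis by (simp add: sum_distrib_right)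
    qed
    then show ?thesis
      unfolding l1_norm_def[of "A *v u"] sum_distrib_right by (rule sum_mono)
  qed
qed

lemma block_col_opnorm_le:
  assumes "\<And>u. l1_norm u = 1 \<Longrightarrow> (\<Sum>j=1..m. l1_norm (M j *v u)) \<le> C"
  shows "block_col_opnorm m M \<le> C"
  unfolding block_col_opnorm_def using assms by (intro cSUP_least unit_l1_nonempty) auto

text \<open>By homogeneity a nonzero \<open>u\<close> may be scaled to norm 1. Boundedness on the
  unit sphere is checked first, since only then is the real supremum an upper bound.\<close>

lemma le_block_col_opnorm: "(\<Sum>j=1..m. l1_norm (M j *v u)) \<le> block_col_opnorm m M * l1_norm u"
proof (cases "u = 0")
  case False
  define r where "r = l1_norm u"
  have r: "r > 0"
    using False l1_norm_nonneg[of u] l1_norm_eq_0[of u] unfolding r_def by linarith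
  obtain C where C: "\<And>j w. l1_norm (M j *v w) \<le> C j * l1_norm w"
    using l1_norm_mult_bounded[of "M _"] by metis
  have "bdd_above ((\<lambda>w. \<Sum>j=1..m. l1_norm (M j *v w)) ` {w. l1_norm w = 1})"
  proof (rule bdd_aboveI2)
    show "(\<Sum>j=1..m. l1_norm (M j *v w)) \<le> (\<Sum>j=1..m. C j)" if "w \<in> {w. l1_norm w = 1}" for w
      using that C[of _ w] by (intro sum_mono) auto
  qed
  moreover have "l1_norm ((1 / r) *\<^sub>R u) = 1"
    using r by (simp add: l1_norm_scaleR flip: r_def)
  ultimately have "(\<Sum>j=1..m. l1_norm (M j *v ((1 / r) *\<^sub>R u))) \<le> block_col_opnorm m M"
    unfolding block_col_opnorm_def by (intro cSUP_upper) auto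
  also have "(\<Sum>j=1..m. l1_norm (M j *v ((1 / r) *\<^sub>R u))) = (\<Sum>j=1..m. l1_norm (M j *v u)) / r"
    using r by (simp add: matrix_vector_mult_scaleR l1_norm_scaleR sum_divide_distrib)
  finally show ?thesis
    using r by (simp add: field_simps flip: r_def)
qed simp

text \<open>A square matrix is a block column with a single block.\<close>

lemma l1_norm_le_l1_opnorm: "l1_norm (A *v u) \<le> l1_opnorm A * l1_norm u"
  using le_block_col_opnorm[where m = 1 and M = "\<lambda>_. A"]
  by (simp add: l1_opnorm_def block_col_opnorm_def)

section \<open>Kernel series\<close>

lemma admissible_kernel_bound:
  assumes "admissible_kernel X K"
  obtains \<kappa> where "\<kappa> > 0" "\<And>s t u. s \<in> X \<Longrightarrow> t \<in> X \<Longrightarrow> l1_norm (K s t *v u) \<le> \<kappa> * l1_norm u"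
proof -
  obtain \<kappa> where \<kappa>: "\<kappa> > 0" "\<And>s t. s \<in> X \<Longrightarrow> t \<in> X \<Longrightarrow> l1_opnorm (K s t) \<le> \<kappa>"
    using assms unfolding admissible_kernel_def by blast
  show thesis
  proof (rule that[OF \<kappa>(1)])
    show "l1_norm (K s t *v u) \<le> \<kappa> * l1_norm u" if "s \<in> X" "t \<in> X" for s t u
      using l1_norm_le_l1_opnorm[of "K s t" u] mult_right_mono[OF \<kappa>(2)[OF that] l1_norm_nonneg[of u]]
      by linarith
  qed
qed

lemma admissible_kernel_inverse:
  assumes "admissible_kernel X K" "m \<ge> 1" "distinct_points X m x"
  shows "is_block_inverse m (kernel_matrix K x) (block_inv m (kernel_matrix K x))"
  using assms unfolding admissible_kernel_def by (blast intro: is_block_inverse_block_inv)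

text \<open>Terms off the support vanish. Summing over all of \<open>X\<close> gives different
  coefficient families a common index set.\<close>

lemma kernel_series_eq:
  assumes "t \<in> X"
  shows "kernel_series X K c t = (\<Sum>\<^sub>\<infinity>s\<in>X. K s t *v c s)"
  using assms unfolding kernel_series_def supp_on_def
  by (auto intro!: infsum_cong_neutral)

lemma kernel_series_summable:
  assumes "admissible_kernel X K" "c \<in> ell1 X" "t \<in> X"
  shows "(\<lambda>s. K s t *v c s) summable_on X"
proof -
  obtain \<kappa> where \<kappa>: "\<And>s t u. s \<in> X \<Longrightarrow> t \<in> X \<Longrightarrow> l1_norm (K s t *v u) \<le> \<kappa> * l1_norm u"
    using admissible_kernel_bound[OF assms(1)] by metis
  have "(\<lambda>s. \<kappa> * l1_norm (c s)) summable_on X"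
    using assms(2) by (auto simp: ell1_def intro: summable_on_cmult_right)
  then have "(\<lambda>s. l1_norm (K s t *v c s)) summable_on X"
    by (rule summable_on_comparison_test) (auto simp: \<kappa> assms(3))
  then show ?thesis by (rule summable_on_if_l1_norm)
qed

text \<open>A finite \<open>X\<close> contains no injective sequence, so uniqueness comes here from
  non-singularity of the kernel matrix at an enumeration of all of \<open>X\<close>.\<close>

lemma kernel_series_trivial_finite:
  assumes "admissible_kernel X K" "finite X" "X \<noteq> {}"
    and "\<And>t. t \<in> X \<Longrightarrow> (\<Sum>\<^sub>\<infinity>s\<in>X. K s t *v c s) = 0" and "s \<in> X"
  shows "c s = 0"
proof -
  define m where "m = card X"
  obtain x where x: "bij_betw x {1..m} X"
    using ex_bij_betw_nat_finite_1[OF assms(2)] unfolding m_def by blast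
  have m: "m \<ge> 1"
    using assms(2,3) by (simp add: m_def Suc_le_eq card_gt_0_iff)
  have dist: "distinct_points X m x"
    using x by (auto simp: distinct_points_def bij_betw_def)
  let ?A = "kernel_matrix K x"
  let ?B = "block_inv m ?A"
  have "block_apply m ?A (c \<circ> x) l = 0" if "l \<in> {1..m}" for l
  proof -
    have "x l \<in> X"
      using that x by (auto simp: bij_betw_def)
    have "block_apply m ?A (c \<circ> x) l = (\<Sum>s\<in>X. K s (x l) *v c s)"
      unfolding block_apply_def kernel_matrix_def
      using sum.reindex_bij_betw[OF x, of "\<lambda>s. K s (x l) *v c s"] by simp
    also have "\<dots> = 0"
      using assms(4)[OF \<open>x l \<in> X\<close>] assms(2) by simp
    finally show ?thesis .
  qed
  then have "block_apply m ?B (block_apply m ?A (c \<circ> x)) = block_apply m ?B (\<lambda>_. 0)"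
    by (intro block_apply_cong) auto
  then have "(c \<circ> x) j = 0" if "j \<in> {1..m}" for j
    using block_apply_block_id[of m ?B ?A j "c \<circ> x"] that
      admissible_kernel_inverse[OF assms(1) m dist]
    by (simp add: is_block_inverse_def block_apply_def)
  then show ?thesis
    using x assms(5) by (auto simp: bij_betw_def)
qed

text \<open>A summable family has countable support, so the series can be rewritten along an
  injective sequence, to which the third admissibility condition applies.\<close>

lemma kernel_series_trivial_infinite:
  assumes "admissible_kernel X K" "infinite X" "c \<in> ell1 X"
    and "\<And>t. t \<in> X \<Longrightarrow> (\<Sum>\<^sub>\<infinity>s\<in>X. K s t *v c s) = 0" and "s \<in> X"
  shows "c s = 0"
proof -
  define S where "S = {s \<in> X. c s \<noteq> 0}"
  have "countable S"
    using summable_countable_real[of "\<lambda>s. l1_norm (c s)" X] assms(3)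
    by (simp add: S_def ell1_def)
  \<comment> \<open>The support may be finite; adjoining a countably infinite \<open>C\<close> gives
    enough points for a sequence, and every point added to the support has coefficient 0.\<close>
  moreover obtain C where C: "C \<subseteq> X" "countable C" "infinite C"
    using infinite_countable_subset'[OF assms(2)] by blast
  ultimately have U: "countable (S \<union> C)" "infinite (S \<union> C)" "S \<union> C \<subseteq> X"
    by (auto simp: S_def)
  \<comment> \<open>The admissibility condition indexes sequences from 1,
    \<open>from_nat_into\<close> from 0.\<close>
  have "bij_betw (\<lambda>j::nat. j - 1) {1..} UNIV"
    by (rule bij_betwI[where g = Suc]) auto
  from bij_betw_trans[OF this bij_betw_from_nat_into[OF U(1,2)]]
  obtain x :: "nat \<Rightarrow> 'a" where x: "bij_betw x {1..} (S \<union> C)"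
    by blast
  have "(\<lambda>s. l1_norm (c s)) summable_on (S \<union> C)"
    using assms(3) U(3) by (auto simp: ell1_def intro: summable_on_subset_banach)
  then have "(c \<circ> x) \<in> ell1 {1..}"
    using summable_on_reindex_bij_betw[OF x, of "\<lambda>s. l1_norm (c s)"] by (simp add: ell1_def)
  moreover have "(\<Sum>\<^sub>\<infinity>j\<in>{1..}. K (x j) t *v (c \<circ> x) j) = 0" if "t \<in> X" for t
  proof -
    have "(\<Sum>\<^sub>\<infinity>j\<in>{1..}. K (x j) t *v (c \<circ> x) j) = (\<Sum>\<^sub>\<infinity>s\<in>S \<union> C. K s t *v c s)"
      using infsum_reindex_bij_betw[OF x, of "\<lambda>s. K s t *v c s"] by simp
    also have "\<dots> = (\<Sum>\<^sub>\<infinity>s\<in>X. K s t *v c s)"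
      using U(3) by (intro infsum_cong_neutral) (auto simp: S_def)
    finally show ?thesis
      using assms(4)[OF that] by simp
  qed
  moreover have "x ` {1..} \<subseteq> X" "inj_on x {1..}"
    using x U(3) by (auto simp: bij_betw_def)
  ultimately have "\<forall>j\<in>{1..}. (c \<circ> x) j = 0"
    using assms(1) unfolding admissible_kernel_def by blast
  then have "c s = 0" if "s \<in> S"
    using that x by (force simp: bij_betw_def)
  then show ?thesis
    using assms(5) by (auto simp: S_def)
qed

lemma kernel_series_inj:
  assumes "admissible_kernel X K" "b \<in> ell1 X" "c \<in> ell1 X"
    and "kernel_series X K b = kernel_series X K c" and "s \<in> X"
  shows "b s = c s"
proof -
  have *: "(\<Sum>\<^sub>\<infinity>s\<in>X. K s t *v (b s - c s)) = 0" if "t \<in> X" for t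
  proof -
    have "((\<lambda>s. K s t *v b s + - (K s t *v c s)) has_sum
        kernel_series X K b t + - kernel_series X K c t) X"
      using kernel_series_summable[OF assms(1,2) that] kernel_series_summable[OF assms(1,3) that]
      unfolding kernel_series_eq[OF that]
      by (intro has_sum_add has_sum_infsum has_sum_uminus[THEN iffD2]) simp_all
    then show ?thesis
      using assms(4) by (simp add: matrix_vector_mult_diff_distrib infsumI)
  qed
  have "b s - c s = 0"
  proof (cases "finite X")
    case True
    then show ?thesis
      using kernel_series_trivial_finite[of X K "\<lambda>s. b s - c s" s] assms(1,5) * by auto
  next
    case False
    then show ?thesis
      using kernel_series_trivial_infinite[OF assms(1) _ ell1_diff[OF assms(2,3)] * assms(5)] by auto
  qed
  then show ?thesis by simp
qed

text \<open>Uniqueness of the coefficients on \<open>X\<close> makes the definite description in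
  \<open>BK_norm\<close> meaningful.\<close>

lemma BK_norm_kernel_series:
  assumes "admissible_kernel X K" "c \<in> ell1 X"
  shows "BK_norm X K (kernel_series X K c) = ell1_norm X c"
  unfolding BK_norm_def
proof (rule the_equality)
  show "\<exists>c'\<in>ell1 X. kernel_series X K c = kernel_series X K c' \<and> ell1_norm X c = ell1_norm X c'"
    using assms(2) by blast
next
  fix r
  assume "\<exists>c'\<in>ell1 X. kernel_series X K c = kernel_series X K c' \<and> r = ell1_norm X c'"
  then obtain c' where c': "c' \<in> ell1 X" "kernel_series X K c = kernel_series X K c'"
      "r = ell1_norm X c'"
    by blast
  then show "r = ell1_norm X c"
    using kernel_series_inj[OF assms c'(1,2)] by (simp add: ell1_norm_def cong: infsum_cong)
qed

section \<open>Finite kernel expansions\<close>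

text \<open>\<open>BK\<close> is parametrised by families on \<open>X\<close>; this moves
  coefficients from indices to points and extends by 0. It is meant for \<open>x\<close> injective
  on \<open>{1..m}\<close>.\<close>

definition point_family :: "nat \<Rightarrow> (nat \<Rightarrow> 'x) \<Rightarrow> (nat \<Rightarrow> real ^ 'd) \<Rightarrow> 'x \<Rightarrow> real ^ 'd" where
  "point_family m x c = (\<lambda>t. if t \<in> x ` {1..m} then c (the_inv_into {1..m} x t) else 0)"

text \<open>The function \<open>F\<close> is left general so that one computation covers both the l1
  norm and the kernel terms.\<close>

lemma
  fixes F :: "'x \<Rightarrow> real ^ 'd \<Rightarrow> 'b :: {topological_comm_monoid_add, t2_space}"
  assumes "distinct_points X m x" "\<And>s. F s 0 = 0"
  shows summable_on_point_family: "(\<lambda>s. F s (point_family m x c s)) summable_on X"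
    and infsum_point_family:
      "(\<Sum>\<^sub>\<infinity>s\<in>X. F s (point_family m x c s)) = (\<Sum>j=1..m. F (x j) (c j))"
proof -
  have x: "x ` {1..m} \<subseteq> X" "inj_on x {1..m}"
    using assms(1) by (auto simp: distinct_points_def)
  show "(\<lambda>s. F s (point_family m x c s)) summable_on X"
    using summable_on_cong_neutral[of "x ` {1..m}" X "\<lambda>s. F s (point_family m x c s)"
        "\<lambda>s. F s (point_family m x c s)"] x assms(2)
    by (auto simp: point_family_def)
  have "(\<Sum>\<^sub>\<infinity>s\<in>X. F s (point_family m x c s)) = (\<Sum>\<^sub>\<infinity>s\<in>x ` {1..m}. F s (point_family m x c s))"
    using x assms(2) by (intro infsum_cong_neutral) (auto simp: point_family_def)
  also have "\<dots> = (\<Sum>j=1..m. F (x j) (c j))"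
    using x(2) by (simp add: sum.reindex point_family_def the_inv_into_f_f)
  finally show "(\<Sum>\<^sub>\<infinity>s\<in>X. F s (point_family m x c s)) = (\<Sum>j=1..m. F (x j) (c j))" .
qed

lemma point_family_ell1:
  assumes "distinct_points X m x"
  shows "point_family m x c \<in> ell1 X"
    and "ell1_norm X (point_family m x c) = (\<Sum>j=1..m. l1_norm (c j))"
  using summable_on_point_family[OF assms, of "\<lambda>_. l1_norm"]
    infsum_point_family[OF assms, of "\<lambda>_. l1_norm"]
  by (simp_all add: ell1_def ell1_norm_def)

lemma kernel_series_point_family:
  assumes "distinct_points X m x"
  shows "kernel_series X K (point_family m x c) = (\<lambda>t\<in>X. \<Sum>j=1..m. K (x j) t *v c j)"
proof
  show "kernel_series X K (point_family m x c) t = (\<lambda>t\<in>X. \<Sum>j=1..m. K (x j) t *v c j) t" for t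
    using infsum_point_family[OF assms, of "\<lambda>s. (*v) (K s t)"]
    by (cases "t \<in> X") (simp_all add: kernel_series_eq, simp add: kernel_series_def)
qed

lemma kernel_expansion_BK:
  assumes "admissible_kernel X K" "distinct_points X m x"
    and "f = (\<lambda>t\<in>X. \<Sum>j=1..m. K (x j) t *v c j)"
  shows "f \<in> BK X K" and "BK_norm X K f = (\<Sum>j=1..m. l1_norm (c j))"
  using point_family_ell1[OF assms(2), of c] BK_norm_kernel_series[OF assms(1), of "point_family m x c"]
  unfolding assms(3) kernel_series_point_family[OF assms(2), of K c, symmetric]
  by (simp_all add: BK_def)

text \<open>The argument order in \<open>kernel_matrix\<close> is what fits: row \<open>l\<close>
  collects the blocks \<open>K (x j) (x l)\<close>.\<close>

lemma sample_kernel_expansion: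
  assumes "distinct_points X m x" "f = (\<lambda>t\<in>X. \<Sum>j=1..m. K (x j) t *v c j)" "l \<in> {1..m}"
  shows "sample m x f l = block_apply m (kernel_matrix K x) c l"
  using assms
  by (auto simp: sample_def block_apply_def kernel_matrix_def distinct_points_def image_subset_iff)

lemma sample_in_Rmd: "sample m x f \<in> Rmd m"
  by (simp add: sample_def Rmd_def)

section \<open>The Lebesgue constant and the representer theorem\<close>

text \<open>Unfolds both suprema, over \<open>t\<close> and over unit vectors, into an inequality
  for every \<open>t\<close> and \<open>u\<close>, the form used in both implications.\<close>

lemma SUP_block_col_opnorm_le_1_iff:
  fixes K :: "'x \<Rightarrow> 'x \<Rightarrow> real ^ 'd ^ 'd::finite"
  assumes "X \<noteq> {}" "admissible_kernel X K" "distinct_points X m x"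
  shows "(SUP t\<in>X. block_col_opnorm m (block_mult_col m B (kernel_col K x t))) \<le> 1 \<longleftrightarrow>
    (\<forall>t\<in>X. \<forall>u. (\<Sum>j=1..m. l1_norm (block_apply m B (\<lambda>l. K t (x l) *v u) j)) \<le> l1_norm u)"
    (is "(SUP t\<in>X. ?N t) \<le> 1 \<longleftrightarrow> ?R")
proof
  have M: "block_mult_col m B (kernel_col K x t) j *v u = block_apply m B (\<lambda>l. K t (x l) *v u) j"
    for t j u by (simp add: block_mult_col_mult kernel_col_def)
  obtain \<kappa> where \<kappa>: "\<And>s t u. s \<in> X \<Longrightarrow> t \<in> X \<Longrightarrow> l1_norm (K s t *v u) \<le> \<kappa> * l1_norm u"
    using admissible_kernel_bound[OF assms(2)] by metis
  obtain C where C: "\<And>j l. C j l \<ge> 0" "\<And>j l u. l1_norm (B j l *v u) \<le> C j l * l1_norm u"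
    using l1_norm_mult_bounded[of "B _ _"] by metis
  \<comment> \<open>A bound on a real supremum limits the single values only if the set is bounded
    above; this is where boundedness of the kernel enters.\<close>
  have "bdd_above (?N ` X)"
  proof (rule bdd_aboveI2, rule block_col_opnorm_le, rule sum_mono)
    fix t j and u :: "real ^ 'd"
    assume t: "t \<in> X" and u: "l1_norm u = 1"
    have "l1_norm (block_apply m B (\<lambda>l. K t (x l) *v u) j)
        \<le> (\<Sum>l=1..m. l1_norm (B j l *v (K t (x l) *v u)))"
      unfolding block_apply_def by (rule l1_norm_sum)
    \<comment> \<open>This constant depends neither on \<open>t\<close> nor on the unit vector
      \<open>u\<close>.\<close>
    also have "\<dots> \<le> (\<Sum>l=1..m. C j l * \<kappa>)"
    proof (rule sum_mono)
      fix l
      assume "l \<in> {1..m}"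
      then have "x l \<in> X"
        using assms(3) by (auto simp: distinct_points_def)
      then have "l1_norm (K t (x l) *v u) \<le> \<kappa>"
        using \<kappa>[OF t, of "x l" u] u by simp
      then show "l1_norm (B j l *v (K t (x l) *v u)) \<le> C j l * \<kappa>"
        using C(2)[of j l "K t (x l) *v u"] mult_left_mono[OF _ C(1)[of j l]] by fastforce
    qed
    finally show "l1_norm (block_mult_col m B (kernel_col K x t) j *v u) \<le> (\<Sum>l=1..m. C j l * \<kappa>)"
      by (simp add: M)
  qed
  note upper = cSUP_upper[OF _ this]
  assume sup: "(SUP t\<in>X. ?N t) \<le> 1"
  show ?R
  proof (intro ballI allI)
    fix t and u :: "real ^ 'd"
    assume "t \<in> X"
    then have "?N t \<le> 1"
      using upper sup by fastforce
    then have "?N t * l1_norm u \<le> l1_norm u"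
      using mult_right_mono[OF _ l1_norm_nonneg] by fastforce
    then show "(\<Sum>j=1..m. l1_norm (block_apply m B (\<lambda>l. K t (x l) *v u) j)) \<le> l1_norm u"
      using le_block_col_opnorm[where m = m and u = u and M = "block_mult_col m B (kernel_col K x t)"] by (simp add: M)
  qed
next
  assume R: ?R
  show "(SUP t\<in>X. ?N t) \<le> 1"
  proof (intro cSUP_least assms(1) block_col_opnorm_le)
    fix t and u :: "real ^ 'd"
    assume "t \<in> X" "l1_norm u = 1"
    then show "(\<Sum>j=1..m. l1_norm (block_mult_col m B (kernel_col K x t) j *v u)) \<le> 1"
      using R by (simp add: block_mult_col_mult kernel_col_def) metis
  qed
qed

text \<open>The bounded linear map given by \<open>B\<close> passes through the kernel series, and
  the term at \<open>t\<close> contributes at most \<open>l1_norm (c t)\<close>; summing over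
  \<open>t\<close> gives the claim.\<close>

lemma sum_l1_norm_block_apply_sample_le:
  assumes "admissible_kernel X K" "distinct_points X m x" "c \<in> ell1 X"
    and bound: "\<And>t u. t \<in> X \<Longrightarrow>
      (\<Sum>j=1..m. l1_norm (block_apply m B (\<lambda>l. K t (x l) *v u) j)) \<le> l1_norm u"
  shows "(\<Sum>j=1..m. l1_norm (block_apply m B (sample m x (kernel_series X K c)) j)) \<le> ell1_norm X c"
proof -
  define w where "w t j = block_apply m B (\<lambda>l. K t (x l) *v c t) j" for t j
  have c: "(\<lambda>t. l1_norm (c t)) summable_on X"
    using assms(3) by (simp add: ell1_def)
  have sum_w: "(\<Sum>j=1..m. l1_norm (w t j)) \<le> l1_norm (c t)" if "t \<in> X" for t
    unfolding w_def using that by (rule bound)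
  \<comment> \<open>Domination by \<open>c\<close> justifies the infinite triangle inequality and
    the exchange of sums below.\<close>
  have w: "(\<lambda>t. l1_norm (w t j)) summable_on X" if "j \<in> {1..m}" for j
    using c
  proof (rule summable_on_comparison_test)
    fix t
    assume "t \<in> X"
    have "l1_norm (w t j) \<le> (\<Sum>j=1..m. l1_norm (w t j))"
      using that by (intro member_le_sum) auto
    also have "\<dots> \<le> l1_norm (c t)"
      by (rule sum_w) fact
    finally show "l1_norm (w t j) \<le> l1_norm (c t)" .
  qed simp
  have "block_apply m B (sample m x (kernel_series X K c)) j = (\<Sum>\<^sub>\<infinity>t\<in>X. w t j)" for j
  proof -
    have "((\<lambda>t. K t (x l) *v c t) has_sum sample m x (kernel_series X K c) l) X"
      if "l \<in> {1..m}" for l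
    proof -
      have "x l \<in> X"
        using assms(2) that by (auto simp: distinct_points_def)
      then show ?thesis
        using has_sum_infsum[OF kernel_series_summable[OF assms(1,3)]] that
        by (simp add: sample_def kernel_series_eq)
    qed
    then have "((\<lambda>t. w t j) has_sum block_apply m B (sample m x (kernel_series X K c)) j) X"
      unfolding w_def block_apply_def
      by (intro has_sum_sum has_sum_bounded_linear[OF matrix_vector_mul_bounded_linear]) auto
    then show ?thesis
      by (simp add: infsumI)
  qed
  then have "(\<Sum>j=1..m. l1_norm (block_apply m B (sample m x (kernel_series X K c)) j))
      \<le> (\<Sum>j=1..m. \<Sum>\<^sub>\<infinity>t\<in>X. l1_norm (w t j))"
    using l1_norm_infsum_le[OF w] by (intro sum_mono) simp
  also have "\<dots> = (\<Sum>\<^sub>\<infinity>t\<in>X. \<Sum>j=1..m. l1_norm (w t j))"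
    using w by (intro infsum_sum[symmetric])
  also have "\<dots> \<le> ell1_norm X c"
    unfolding ell1_norm_def using w c sum_w
    by (intro infsum_mono summable_on_sum) auto
  finally show ?thesis .
qed

text \<open>The function \<open>g\<close> is the interpolant in the span of the values of
  \<open>f\<close>, not of \<open>y\<close>: the loss term stays equal for any
  \<open>L\<close>.\<close>

lemma reg_network_minimizer_in_kernel_span:
  assumes "admissible_kernel X K" "m \<ge> 1" "distinct_points X m x"
    and "regularizer \<phi>" "\<mu> > 0" "reg_network_minimizer X K m x y L \<phi> \<mu> f"
    and bound: "\<And>t u. t \<in> X \<Longrightarrow>
      (\<Sum>j=1..m. l1_norm (block_apply m (block_inv m (kernel_matrix K x)) (\<lambda>l. K t (x l) *v u) j))
        \<le> l1_norm u"
  shows "\<exists>g\<in>kernel_span X K m x. reg_network_minimizer X K m x y L \<phi> \<mu> g"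
proof -
  let ?A = "kernel_matrix K x"
  let ?B = "block_inv m ?A"
  have inv: "is_block_id m (block_mult m ?A ?B)"
    using admissible_kernel_inverse[OF assms(1-3)] by (simp add: is_block_inverse_def)
  obtain c where c: "c \<in> ell1 X" "f = kernel_series X K c"
    using assms(6) by (auto simp: reg_network_minimizer_def is_arg_min_def BK_def)
  define b where "b = block_apply m ?B (sample m x f)"
  define g where "g = (\<lambda>t\<in>X. \<Sum>j=1..m. K (x j) t *v b j)"
  have g: "g \<in> BK X K" "BK_norm X K g = (\<Sum>j=1..m. l1_norm (b j))"
    using kernel_expansion_BK[OF assms(1,3) g_def] by auto
  have sample: "sample m x g = sample m x f"
  proof
    show "sample m x g l = sample m x f l" for l
    proof (cases "l \<in> {1..m}")
      case True
      then show ?thesis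
        using sample_kernel_expansion[OF assms(3) g_def True] block_apply_block_id[OF inv True]
        by (simp add: b_def)
    \<comment> \<open>Outside \<open>{1..m}\<close> both samples are
      \<open>undefined\<close>.\<close>
    qed (auto simp: sample_def)
  qed
  have "BK_norm X K g \<le> BK_norm X K f"
    using sum_l1_norm_block_apply_sample_le[OF assms(1,3) c(1) bound] g(2)
      BK_norm_kernel_series[OF assms(1) c(1)]
    by (simp add: b_def c(2))
  \<comment> \<open>Monotonicity of \<open>\<phi>\<close> is given on \<open>{0..}\<close> only; the
    norm of \<open>f\<close> lies there too, being at least that of \<open>g\<close>.\<close>
  moreover have "0 \<le> BK_norm X K g"
    by (simp add: g(2) sum_nonneg)
  ultimately have "\<phi> (BK_norm X K g) \<le> \<phi> (BK_norm X K f)"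
    using assms(4) mono_onD[of "{0..}" \<phi> "BK_norm X K g" "BK_norm X K f"]
    by (simp add: regularizer_def)
  then have le: "L (sample m x g) y + \<mu> * \<phi> (BK_norm X K g)
      \<le> L (sample m x f) y + \<mu> * \<phi> (BK_norm X K f)"
    using assms(5) by (simp add: sample)
  have "reg_network_minimizer X K m x y L \<phi> \<mu> g"
    using assms(6) g(1) order.strict_trans2[OF _ le]
    unfolding reg_network_minimizer_def is_arg_min_def by blast
  moreover have "g \<in> kernel_span X K m x"
    unfolding kernel_span_def g_def by blast
  ultimately show ?thesis by blast
qed

text \<open>With \<open>B\<close> the inverse kernel matrix, this loss compares the coefficients of
  interpolants in the span rather than values, in the same l1 norm that gives \<open>BK_norm\<close>
  on the span.\<close>

lemma loss_function_block_apply: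
  fixes B :: "'d::finite blocks"
  shows "loss_function m (\<lambda>s t. \<Sum>j=1..m. l1_norm (block_apply m B (\<lambda>l. s l - t l) j))"
proof -
  have "continuous_on S (\<lambda>p. fst p l - snd p l)"
    for l and S :: "((nat \<Rightarrow> real ^ 'd) \<times> (nat \<Rightarrow> real ^ 'd)) set"
    by (rule continuous_on_diff;
        rule continuous_on_product_then_coordinatewise[where i = l];
        rule continuous_on_fst continuous_on_snd; rule continuous_on_id)
  then have "continuous_on S (\<lambda>p. block_apply m B (\<lambda>l. fst p l - snd p l) j)"
    for j and S :: "((nat \<Rightarrow> real ^ 'd) \<times> (nat \<Rightarrow> real ^ 'd)) set"
    unfolding block_apply_def
    by (rule continuous_on_sum[OF bounded_linear.continuous_on[OF matrix_vector_mul_bounded_linear]])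
  then have "continuous_on (Rmd m \<times> Rmd m)
      (\<lambda>p. \<Sum>j=1..m. l1_norm (block_apply m B (\<lambda>l. fst p l - snd p l) j))"
    by (rule continuous_on_sum[OF continuous_on_l1_norm])
  then show ?thesis
    unfolding loss_function_def split_beta by (simp add: sum_nonneg block_apply_def)
qed

lemma regularizer_id: "regularizer (\<lambda>t. t)"
  by (auto simp: regularizer_def mono_on_def filterlim_ident)

text \<open>Loss and regularizer have equal weight, so the triangle inequality bounds the
  coefficient norm of the interpolant of \<open>y\<close> by the objective at any element of the
  span.\<close>

lemma reg_network_representer_bound:
  assumes "admissible_kernel X K" "m \<ge> 1" "distinct_points X m x"
    and "reg_network_representer X K" "t \<in> X"
  shows "(\<Sum>j=1..m. l1_norm (block_apply m (block_inv m (kernel_matrix K x)) (\<lambda>l. K t (x l) *v u) j))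
    \<le> l1_norm u"
proof -
  let ?A = "kernel_matrix K x"
  let ?B = "block_inv m ?A"
  let ?L = "\<lambda>s t. \<Sum>j=1..m. l1_norm (block_apply m ?B (\<lambda>l. s l - t l) j)"
  have inv: "is_block_id m (block_mult m ?B ?A)"
    using admissible_kernel_inverse[OF assms(1-3)] by (simp add: is_block_inverse_def)
  \<comment> \<open>The competitor \<open>K(t,.) u\<close>, written as an expansion at one point so
    that its norm is already known.\<close>
  define h where "h = (\<lambda>s\<in>X. \<Sum>j=(1::nat)..1. K t s *v u)"
  have "distinct_points X 1 (\<lambda>_. t)"
    using assms(5) by (simp add: distinct_points_def)
  from kernel_expansion_BK[OF assms(1) this h_def]
  have h: "h \<in> BK X K" "BK_norm X K h = l1_norm u"
    by simp_all
  define y where "y = sample m x h"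
  have y: "y l = K t (x l) *v u" if "l \<in> {1..m}" for l
    using that assms(3) by (auto simp: y_def h_def sample_def distinct_points_def image_subset_iff)
  have "sampling_data X m x y"
    using assms(2,3) by (simp add: sampling_data_def y_def sample_in_Rmd)
  with assms(4) loss_function_block_apply[of m ?B] regularizer_id
  obtain f where f: "f \<in> kernel_span X K m x" "reg_network_minimizer X K m x y ?L (\<lambda>t. t) 1 f"
    unfolding reg_network_representer_def using zero_less_one by blast
  obtain c where c: "f = (\<lambda>t\<in>X. \<Sum>j=1..m. K (x j) t *v c j)"
    using f(1) by (auto simp: kernel_span_def)
  \<comment> \<open>The inverse applied to the sample of \<open>f\<close> returns the coefficients
    \<open>c\<close>.\<close>
  have loss: "block_apply m ?B (\<lambda>l. sample m x f l - y l) j = c j - block_apply m ?B y j"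
    if "j \<in> {1..m}" for j
    unfolding block_apply_diff
    using block_apply_cong[of m "sample m x f" "block_apply m ?A c" ?B]
      sample_kernel_expansion[OF assms(3) c] block_apply_block_id[OF inv that, of c]
    by simp
  \<comment> \<open>The data \<open>y\<close> are sampled from \<open>h\<close>, so \<open>h\<close>
    has zero loss and its objective is \<open>l1_norm u\<close>.\<close>
  have "?L (sample m x f) y + BK_norm X K f \<le> ?L (sample m x h) y + BK_norm X K h"
    using f(2) h(1) by (force simp: reg_network_minimizer_def is_arg_min_def not_less)
  then have min: "?L (sample m x f) y + BK_norm X K f \<le> l1_norm u"
    by (simp add: h(2) y_def block_apply_def)
  have "(\<Sum>j=1..m. l1_norm (block_apply m ?B y j))
      \<le> (\<Sum>j=1..m. l1_norm (c j - block_apply m ?B y j) + l1_norm (c j))"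
  proof (rule sum_mono)
    show "l1_norm (block_apply m ?B y j) \<le> l1_norm (c j - block_apply m ?B y j) + l1_norm (c j)" for j
      using l1_norm_diff_le[of "c j" "c j - block_apply m ?B y j"] by simp
  qed
  also have "\<dots> = ?L (sample m x f) y + BK_norm X K f"
    unfolding kernel_expansion_BK(2)[OF assms(1,3) c] by (simp add: sum.distrib loss)
  also note min
  finally show ?thesis
    using block_apply_cong[of m y "\<lambda>l. K t (x l) *v u" ?B] y by simp
qed

theorem corollary3p4:
  fixes X :: "'x set" and K :: "'x \<Rightarrow> 'x \<Rightarrow> real ^ 'd ^ 'd::finite"
  assumes "X \<noteq> {}"
    and "admissible_kernel X K"
    and "\<And>m x y. sampling_data X m x y \<Longrightarrow> \<exists>f. min_norm_interpolant X K m x y f"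
    and "\<And>m x y L \<phi> \<mu>. sampling_data X m x y \<Longrightarrow> loss_function m L \<Longrightarrow> regularizer \<phi> \<Longrightarrow> \<mu> > 0 \<Longrightarrow>
           \<exists>f. reg_network_minimizer X K m x y L \<phi> \<mu> f"
  shows "reg_network_representer X K \<longleftrightarrow>
         (\<forall>m\<ge>1. \<forall>x. distinct_points X m x \<longrightarrow>
            (SUP t\<in>X. block_col_opnorm m
               (block_mult_col m (block_inv m (kernel_matrix K x)) (kernel_col K x t))) \<le> 1)"
proof -
  let ?B = "\<lambda>m x. block_inv m (kernel_matrix K x)"
  \<comment> \<open>The equivalence is proved for the inequality in \<open>t\<close> and
    \<open>u\<close> first, then translated back to the supremum.\<close>
  have "reg_network_representer X K \<longleftrightarrow>
    (\<forall>m\<ge>1. \<forall>x. distinct_points X m x \<longrightarrow>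
      (\<forall>t\<in>X. \<forall>u. (\<Sum>j=1..m. l1_norm (block_apply m (?B m x) (\<lambda>l. K t (x l) *v u) j)) \<le> l1_norm u))"
    (is "_ \<longleftrightarrow> ?R")
  proof
    assume "reg_network_representer X K"
    then show ?R
      using reg_network_representer_bound[OF assms(2)] by blast
  next
    assume R: ?R
    show "reg_network_representer X K"
      unfolding reg_network_representer_def
    proof (intro allI impI, elim conjE)
      fix m x and y :: "nat \<Rightarrow> real ^ 'd"
        and L :: "(nat \<Rightarrow> real ^ 'd) \<Rightarrow> (nat \<Rightarrow> real ^ 'd) \<Rightarrow> real" and \<phi> and \<mu> :: real
      assume *: "sampling_data X m x y" "loss_function m L" "regularizer \<phi>" "\<mu> > 0"
      then obtain f where "reg_network_minimizer X K m x y L \<phi> \<mu> f"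
        using assms(4) by blast
      moreover have "m \<ge> 1" "distinct_points X m x"
        using *(1) by (auto simp: sampling_data_def)
      ultimately show "\<exists>f\<in>kernel_span X K m x. reg_network_minimizer X K m x y L \<phi> \<mu> f"
        using reg_network_minimizer_in_kernel_span[OF assms(2) _ _ *(3,4)] R by blast
    qed
  qed
  then show ?thesis
    using SUP_block_col_opnorm_le_1_iff[OF assms(1,2)] by simp
qed

end
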